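(* Let $W>0$, $T>0$, $N\in(0,1)$, $\sigma\ge 0$, $r_c\ge 0$, and let $F_{\max}(T)\ge 0$ be a fixed real number not depending on $X$. For $X>0$ let $G_X$ be the symmetric two-player game, with actions $\mathrm{std}$ and $\mathrm{HLCP}$ for each player, and payoffs $\pi_{a,b}(T)$ (the payoff of a player choosing $a$ when the other player chooses $b$) as defined in the context. Let $G_\infty$ be the limit game whose payoffs are $\pi^{\infty}_{a,b}:=\lim_{X\to\infty}\pi_{a,b}(T)$. Suppose that $\sigma>0$ or $r_c>0$. Then in $G_\infty$ the action $\mathrm{HLCP}$ yields a strictly higher payoff than the action $\mathrm{std}$ against each action of the opponent, i.e. $\pi^\infty_{\mathrm{HLCP},b}>\pi^\infty_{\mathrm{std},b}$ for $b\in\{\mathrm{std},\mathrm{HLCP}\}$. Hence the profile $(\mathrm{HLCP},\mathrm{HLCP})$ is the unique Nash equilibrium of $G_\infty$.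
   Context: Two liquidity providers each hold capital $W$ and choose between a standard automated market maker (action $\mathrm{std}$, all of $W$ active) and the Hybrid Liquidity-Collateral Pool (action $\mathrm{HLCP}$, only $N\cdot W$ active and the remaining $(1-N)W$ held as collateral). Here $X$ is the background liquidity, $T$ the time horizon in years, $F_{\max}(T)$ the aggregate fee revenue over the horizon, $\sigma$ the volatility and $r_c$ the annualized collateral yield rate. Put $$\mathrm{LVR}_W(T):=\frac{\sigma^2}{8}WT,\qquad Y_C(T):=(1-N)W r_c T.$$ The payoffs are $$\pi_{\mathrm{std},\mathrm{std}}(T)=\frac{W}{X+2W}F_{\max}(T)-\mathrm{LVR}_W(T),$$ $$\pi_{\mathrm{HLCP},\mathrm{std}}(T)=\frac{N W}{X+(1+N)W}F_{\max}(T)-N\,\mathrm{LVR}_W(T)+Y_C(T),$$ $$\pi_{\mathrm{std},\mathrm{HLCP}}(T)=\frac{W}{X+(1+N)W}F_{\max}(T)-\mathrm{LVR}_W(T),$$ $$\pi_{\mathrm{HLCP},\mathrm{HLCP}}(T)=\frac{N W}{X+2N W}F_{\max}(T)-N\,\mathrm{LVR}_W(T)+Y_C(T),$$ where the first index is the player's own action and the second is the opponent's action. If player A plays $a$ and player B plays $b$, then A receives $\pi_{a,b}$ and B receives $\pi_{b,a}$. *)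

theory Defs
  imports "HOL-Probability.Probability"
begin

datatype action = std | HLCP

definition LVR :: "real \<Rightarrow> real \<Rightarrow> real \<Rightarrow> real" where
  "LVR \<sigma> W T = \<sigma>\<^sup>2 / 8 * W * T"

definition collateral_yield :: "real \<Rightarrow> real \<Rightarrow> real \<Rightarrow> real \<Rightarrow> real" where
  "collateral_yield N W rc T = (1 - N) * W * rc * T"

text \<open>
  In \<open>payoff\<close> and \<open>limit_payoff\<close> the first action is the player's own one,
  the second the opponent's. \<open>Fmax\<close> maps the time horizon to the aggregate
  fee revenue and does not depend on the background liquidity \<open>X\<close>.
\<close>

fun payoff ::
  "real \<Rightarrow> real \<Rightarrow> real \<Rightarrow> real \<Rightarrow> (real \<Rightarrow> real) \<Rightarrow> real \<Rightarrow> real \<Rightarrow> action \<Rightarrow> action \<Rightarrow> real" where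
  "payoff W N \<sigma> rc Fmax T X std std =
     W / (X + 2 * W) * Fmax T - LVR \<sigma> W T"
| "payoff W N \<sigma> rc Fmax T X HLCP std =
     N * W / (X + (1 + N) * W) * Fmax T - N * LVR \<sigma> W T + collateral_yield N W rc T"
| "payoff W N \<sigma> rc Fmax T X std HLCP =
     W / (X + (1 + N) * W) * Fmax T - LVR \<sigma> W T"
| "payoff W N \<sigma> rc Fmax T X HLCP HLCP =
     N * W / (X + 2 * N * W) * Fmax T - N * LVR \<sigma> W T + collateral_yield N W rc T"

definition limit_payoff ::
  "real \<Rightarrow> real \<Rightarrow> real \<Rightarrow> real \<Rightarrow> (real \<Rightarrow> real) \<Rightarrow> real \<Rightarrow> action \<Rightarrow> action \<Rightarrow> real" where
  "limit_payoff W N \<sigma> rc Fmax T a b = Lim at_top (\<lambda>X. payoff W N \<sigma> rc Fmax T X a b)"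

text \<open>
  Two-player games are given by the payoff functions \<open>uA\<close> and \<open>uB\<close> of the two
  players; both take the action of player A first and that of player B second.
\<close>

definition nash_equilibrium ::
  "('a \<Rightarrow> 'b \<Rightarrow> real) \<Rightarrow> ('a \<Rightarrow> 'b \<Rightarrow> real) \<Rightarrow> 'a \<times> 'b \<Rightarrow> bool" where
  "nash_equilibrium uA uB = (\<lambda>(a, b).
     (\<forall>a'. uA a' b \<le> uA a b) \<and> (\<forall>b'. uB a b' \<le> uB a b))"

text \<open>The mixed extension: independent randomization, expected payoffs.\<close>

definition mixed ::
  "('a \<Rightarrow> 'b \<Rightarrow> real) \<Rightarrow> 'a pmf \<Rightarrow> 'b pmf \<Rightarrow> real" where
  "mixed u p q = measure_pmf.expectation (pair_pmf p q) (\<lambda>(a, b). u a b)"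

text \<open>In the symmetric game with payoff \<open>u\<close>, player B receives \<open>u b a\<close> when A plays
  \<open>a\<close> and B plays \<open>b\<close>.\<close>

definition nash_equilibria_symmetric_game :: "('a \<Rightarrow> 'a \<Rightarrow> real) \<Rightarrow> ('a \<times> 'a) set" where
  "nash_equilibria_symmetric_game u = {s. nash_equilibrium u (\<lambda>a b. u b a) s}"

definition mixed_nash_equilibria_symmetric_game ::
  "('a \<Rightarrow> 'a \<Rightarrow> real) \<Rightarrow> ('a pmf \<times> 'a pmf) set" where
  "mixed_nash_equilibria_symmetric_game u =
     {s. nash_equilibrium (mixed u) (mixed (\<lambda>a b. u b a)) s}"

end

theory Submission
  imports Defs "HOL-Real_Asymp.Real_Asymp"
begin

text \<open>
  As the background liquidity grows, every fee share tends to 0, so a player's limit payoff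
  depends only on the own action, and HLCP beats std by
  \<open>(1 - N) * W * T * (\<sigma>\<^sup>2 / 8 + rc) > 0\<close>. A strictly dominant action
  strictly beats every mixed strategy other than the point mass on it,
  which settles both the pure and the mixed equilibria.
\<close>

instance action :: finite
proof
  have "(UNIV :: action set) \<subseteq> {std, HLCP}"
    using action.exhaust by blast
  then show "finite (UNIV :: action set)"
    by (rule finite_subset) (intro finite.intros)
qed

text \<open>The sums are nested so that the inner one is the expected payoff of the pure action
  \<open>a\<close> against \<open>q\<close>; the mixed payoff is then an average over the own action
  alone.\<close>

lemma mixed_eq_sum:
  fixes u :: "'a::finite \<Rightarrow> 'b::finite \<Rightarrow> real"
  shows "mixed u p q = (\<Sum>a\<in>UNIV. pmf p a * (\<Sum>b\<in>UNIV. pmf q b * u a b))"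
proof -
  have "mixed u p q = (\<Sum>x\<in>UNIV \<times> UNIV. (case x of (a, b) \<Rightarrow> u a b) * pmf (pair_pmf p q) x)"
    unfolding mixed_def by (rule integral_measure_pmf_real) auto
  also have "\<dots> = (\<Sum>a\<in>UNIV. \<Sum>b\<in>UNIV. u a b * (pmf p a * pmf q b))"
    unfolding sum.cartesian_product
    by (intro sum.cong) (auto simp: pmf_pair)
  also have "\<dots> = (\<Sum>a\<in>UNIV. pmf p a * (\<Sum>b\<in>UNIV. pmf q b * u a b))"
    by (simp add: sum_distrib_left mult_ac)
  finally show ?thesis .
qed

text \<open>Needed to see that randomizing keeps a symmetric game symmetric, now with distributions
  as actions.\<close>

lemma mixed_swap:
  fixes u :: "'b::finite \<Rightarrow> 'a::finite \<Rightarrow> real"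
  shows "mixed (\<lambda>a b. u b a) p q = mixed u q p"
  unfolding mixed_eq_sum sum_distrib_left
  by (subst sum.swap) (simp add: mult_ac)

lemma sum_pmf_UNIV: "(\<Sum>a\<in>UNIV. pmf p a) = 1" for p :: "'a::finite pmf"
  by (rule sum_pmf_eq_1) auto

text \<open>A point of the support carries positive weight, so strictness at that point survives
  averaging.\<close>

lemma sum_pmf_strict_mono:
  fixes p :: "'a::finite pmf" and f g :: "'a \<Rightarrow> real"
  assumes "\<And>a. f a \<le> g a" and "a \<in> set_pmf p" and "f a < g a"
  shows "(\<Sum>a\<in>UNIV. pmf p a * f a) < (\<Sum>a\<in>UNIV. pmf p a * g a)"
proof (rule sum_strict_mono_ex1)
  show "\<forall>a\<in>UNIV. pmf p a * f a \<le> pmf p a * g a"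
    using assms(1) by (simp add: mult_left_mono)
  show "\<exists>a\<in>UNIV. pmf p a * f a < pmf p a * g a"
    using assms(2,3) by (intro bexI[of _ a]) (auto simp: pmf_positive)
qed simp

lemma mixed_strictly_dominant:
  fixes u :: "'a::finite \<Rightarrow> 'b::finite \<Rightarrow> real"
  assumes dom: "\<And>a b. a \<noteq> d \<Longrightarrow> u a b < u d b" and "p \<noteq> return_pmf d"
  shows "mixed u p q < mixed u (return_pmf d) q"
proof -
  define v where "v a = (\<Sum>b\<in>UNIV. pmf q b * u a b)" for a
  obtain b where b: "b \<in> set_pmf q"
    using set_pmf_not_empty by fast
  \<comment> \<open>Averaging over the opponent: dominance is strict everywhere, so any support
    point of \<open>q\<close> will do.\<close>
  have less: "v a < v d" if "a \<noteq> d" for a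
    unfolding v_def using b dom[OF that] by (intro sum_pmf_strict_mono[of _ _ b]) (auto intro: less_imp_le)
  then have le: "v a \<le> v d" for a
    by (cases "a = d") (auto intro: less_imp_le)
  \<comment> \<open>Averaging over the own action is strict only because \<open>p\<close>, not being
    the point mass, gives weight to some action other than \<open>d\<close>.\<close>
  obtain a where a: "a \<in> set_pmf p" "a \<noteq> d"
    using assms(2) set_pmf_subset_singleton[of p d] by blast
  have "mixed u p q < (\<Sum>a\<in>UNIV. pmf p a * v d)"
    unfolding mixed_eq_sum v_def[symmetric]
    using le a less by (intro sum_pmf_strict_mono[of _ _ a])
  also have "\<dots> = v d"
    by (simp add: sum_distrib_right[symmetric] sum_pmf_UNIV)
  also have "\<dots> = mixed u (return_pmf d) q"
    unfolding mixed_eq_sum v_def[symmetric] by (simp add: indicator_def)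
  finally show ?thesis .
qed

text \<open>Whoever does not play \<open>d\<close> gains by switching to it. The action type is
  arbitrary, so the result also applies to games whose actions are distributions.\<close>

lemma nash_equilibria_symmetric_game_strictly_dominant:
  assumes dom: "\<And>a b. a \<noteq> d \<Longrightarrow> u a b < u d b"
  shows "nash_equilibria_symmetric_game u = {(d, d)}"
proof -
  have le: "u a b \<le> u d b" for a b
    using dom[of a b] by (cases "a = d") auto
  have "a = d" if "\<forall>a'. u a' b \<le> u a b" for a b
    using dom[of a b] that[rule_format, of d] by force
  with le have "nash_equilibrium u (\<lambda>a b. u b a) (a, b) \<longleftrightarrow> a = d \<and> b = d" for a b
    unfolding nash_equilibrium_def prod.case by blast
  then show ?thesis
    unfolding nash_equilibria_symmetric_game_def by auto
qed

lemma mixed_nash_equilibria_symmetric_game_strictly_dominant: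
  fixes u :: "'a::finite \<Rightarrow> 'a \<Rightarrow> real"
  assumes "\<And>a b. a \<noteq> d \<Longrightarrow> u a b < u d b"
  shows "mixed_nash_equilibria_symmetric_game u = {(return_pmf d, return_pmf d)}"
proof -
  have "mixed (\<lambda>a b. u b a) = (\<lambda>p q. mixed u q p)"
    by (intro ext mixed_swap)
  then have "mixed_nash_equilibria_symmetric_game u = nash_equilibria_symmetric_game (mixed u)"
    unfolding mixed_nash_equilibria_symmetric_game_def nash_equilibria_symmetric_game_def by simp
  then show ?thesis
    \<comment> \<open>The pure result is applied to the mixed extension, where the point mass on
      \<open>d\<close> is strictly dominant.\<close>
    using nash_equilibria_symmetric_game_strictly_dominant[of "return_pmf d" "mixed u"]
      mixed_strictly_dominant[of d u] assms by blast
qed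

definition limit_value :: "real \<Rightarrow> real \<Rightarrow> real \<Rightarrow> real \<Rightarrow> real \<Rightarrow> action \<Rightarrow> real" where
  "limit_value W N \<sigma> rc T a =
     (case a of std \<Rightarrow> - LVR \<sigma> W T | HLCP \<Rightarrow> - N * LVR \<sigma> W T + collateral_yield N W rc T)"

lemma tendsto_payoff:
  "((\<lambda>X. payoff W N \<sigma> rc Fmax T X a b) \<longlongrightarrow> limit_value W N \<sigma> rc T a) at_top"
proof -
  \<comment> \<open>The two payoff shapes, without and with collateral yield \<open>y\<close>; the
    opponent's action affects only \<open>k\<close>, which the limit forgets.\<close>
  have *: "((\<lambda>X. c / (X + k) * Fmax T - l) \<longlongrightarrow> - l) at_top"
    "((\<lambda>X. c / (X + k) * Fmax T - l + y) \<longlongrightarrow> y - l) at_top" for c k l y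
    by real_asymp+
  show ?thesis
    \<comment> \<open>Deleting the rule keeps the fee share as a separate quotient, matching the
      pattern of \<open>*\<close>.\<close>
    by (cases a; cases b) (simp_all add: limit_value_def * del: times_divide_eq_left)
qed

text \<open>\<open>Lim\<close> is a choice of a limit, so its value is known only from convergence
  and uniqueness of limits.\<close>

lemma limit_payoff_eq: "limit_payoff W N \<sigma> rc Fmax T a b = limit_value W N \<sigma> rc T a"
  unfolding limit_payoff_def using tendsto_payoff by (intro tendsto_Lim) auto

text \<open>Withdrawing the share \<open>1 - N\<close> from the pool saves that share of the LVR and
  earns yield on it; at least one of the two gains is positive.\<close>

lemma limit_value_less:
  assumes "W > 0" and "T > 0" and "N < 1" and "rc \<ge> 0" and "\<sigma> > 0 \<or> rc > 0"
  shows "limit_value W N \<sigma> rc T std < limit_value W N \<sigma> rc T HLCP"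
proof -
  have "0 < \<sigma>\<^sup>2 / 8 + rc"
    using assms(4,5) by (auto intro: add_pos_nonneg add_nonneg_pos)
  then have "0 < (1 - N) * W * T * (\<sigma>\<^sup>2 / 8 + rc)"
    using assms(1-3) by simp
  also have "\<dots> = limit_value W N \<sigma> rc T HLCP - limit_value W N \<sigma> rc T std"
    by (simp add: limit_value_def LVR_def collateral_yield_def field_simps)
  finally show ?thesis
    by simp
qed

theorem theorem13:
  fixes W T N \<sigma> rc :: real and Fmax :: "real \<Rightarrow> real"
  assumes "W > 0" and "T > 0" and "0 < N" and "N < 1"
    and "\<sigma> \<ge> 0" and "rc \<ge> 0" and "Fmax T \<ge> 0"
    and "\<sigma> > 0 \<or> rc > 0"
  shows "(\<forall>a b. ((\<lambda>X. payoff W N \<sigma> rc Fmax T X a b) \<longlongrightarrow>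
                   limit_payoff W N \<sigma> rc Fmax T a b) at_top) \<and>
         (\<forall>b. limit_payoff W N \<sigma> rc Fmax T HLCP b > limit_payoff W N \<sigma> rc Fmax T std b) \<and>
         nash_equilibria_symmetric_game (limit_payoff W N \<sigma> rc Fmax T) = {(HLCP, HLCP)} \<and>
         mixed_nash_equilibria_symmetric_game (limit_payoff W N \<sigma> rc Fmax T) =
           {(return_pmf HLCP, return_pmf HLCP)}"
proof -
  have less: "limit_payoff W N \<sigma> rc Fmax T std b < limit_payoff W N \<sigma> rc Fmax T HLCP b" for b
    unfolding limit_payoff_eq using assms by (intro limit_value_less)
  then have dom: "limit_payoff W N \<sigma> rc Fmax T a b < limit_payoff W N \<sigma> rc Fmax T HLCP b"
    if "a \<noteq> HLCP" for a b
    using that by (cases a) auto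
  have "((\<lambda>X. payoff W N \<sigma> rc Fmax T X a b) \<longlongrightarrow> limit_payoff W N \<sigma> rc Fmax T a b) at_top" for a b
    unfolding limit_payoff_eq by (rule tendsto_payoff)
  then show ?thesis
    using less nash_equilibria_symmetric_game_strictly_dominant[of HLCP "limit_payoff W N \<sigma> rc Fmax T", OF dom]
      mixed_nash_equilibria_symmetric_game_strictly_dominant[of HLCP "limit_payoff W N \<sigma> rc Fmax T", OF dom]
    by (intro conjI allI)
qed

end
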